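(* Let $n\geq 1$. For any $\mu,\mu'\in\mathsf{BP}_n$, we have $\mu\equiv_\star\mu'$ if and only if for every automata network $f:X\to X$ of size $n$ (that is, for every choice of finite non-empty alphabets $X_0,\dots,X_{n-1}$, with $X=\prod_{i\in\llbracket n\rrbracket}X_i$, and every function $f:X\to X$), $f^{\Omega}_{\{\mu\}}\sim f^{\Omega}_{\{\mu'\}}$.
   Context: Notation: $\llbracket n\rrbracket=\{0,\dots,n-1\}$. A partitioned order of $\llbracket n\rrbracket$ is an (unordered) set $\{S_k\}_{k\in\llbracket s\rrbracket}$ of $s$ sequences $S_k=(i^k_0,\dots,i^k_{n_k-1})$ with $n_k>0$, each consisting of pairwise distinct elements of $\llbracket n\rrbracket$, the sequences being pairwise disjoint (as sets of entries) with union $\llbracket n\rrbracket$. $\mathsf{BP}_n$ is the set of all partitioned orders of $\llbracket n\rrbracket$ (block-parallel update modes of size $n$). For $\mu=\{S_k\}_{k\in\llbracket s\rrbracket}\in\mathsf{BP}_n$, let $p=\mathrm{lcm}(n_0,\dots,n_{s-1})$ and define the sequence of blocks $\varphi(\mu)=(W_\ell)_{\ell\in\llbracket p\rrbracket}$ by $W_\ell=\{i^k_{\ell \bmod n_k}\mid k\in\llbracket s\rrbracket\}$; write $|\varphi(\mu)|=p$. $\sigma^i$ denotes the circular shift of order $i\in\mathbb{Z}$ on finite sequences, moving the element at position $0$ to position $i$ (positions modulo the length). For $\mu,\mu'\in\mathsf{BP}_n$, $\mu\equiv_\star\mu'$ means $\varphi(\mu)=\sigma^i(\varphi(\mu'))$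 for some $i\in\llbracket|\varphi(\mu')|\rrbracket$. Automata networks: an automata network of size $n$ is a function $f:X\to X$ with $X=\prod_{i\in\llbracket n\rrbracket}X_i$, each $X_i$ being a finite alphabet; $f_i:X\to X_i$ is the $i$-th component of $f$. For $W\subseteq\llbracket n\rrbracket$, $f_{(W)}:X\to X$ is defined by $f_{(W)}(x)_i=f_i(x)$ if $i\in W$ and $f_{(W)}(x)_i=x_i$ otherwise. For $\mu\in\mathsf{BP}_n$ with $\varphi(\mu)=(W_0,\dots,W_{p-1})$, the update of $f$ under $\mu$ is $f_{\{\mu\}}=f_{(W_{p-1})}\circ\dots\circ f_{(W_1)}\circ f_{(W_0)}$. Limit dynamics: the limit set of $f_{\{\mu\}}$ is $\Omega_{f_{\{\mu\}}}=\bigcap_{t\in\mathbb{N}} (f_{\{\mu\}})^t(X)$ (iterated images), and $f^{\Omega}_{\{\mu\}}:\Omega_{f_{\{\mu\}}}\to\Omega_{f_{\{\mu\}}}$ is the restriction of $f_{\{\mu\}}$ to its limit set. For two such maps $g:A\to A$, $h:B\to B$, $g\sim h$ means that their functional digraphs (vertex set $A$ with arcs $(x,g(x))$, resp. vertex set $B$ with arcs $(y,h(y))$) are isomorphic, i.e. there is a bijection $\pi:A\to B$ with $g(x)=y\iff h(\pi(x))=\pi(y)$ for all $x,y\in A$. *)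

theory Defs
  imports Complex_Main "HOL-Library.FuncSet" "HOL-Library.Infinite_Typeclass"
begin

section \<open>Block-parallel update modes\<close>

text \<open>
  A partitioned order is a set of lists. The lists are nonempty and pairwise disjoint, so they
  are automatically pairwise distinct, and the set is automatically finite; a set of lists
  therefore carries the same data as an unordered indexed family of sequences.
\<close>

definition BP :: "nat \<Rightarrow> nat list set set" where
  "BP n = {\<mu>. (\<forall>S\<in>\<mu>. S \<noteq> [] \<and> distinct S) \<and>
              pairwise (\<lambda>S T. set S \<inter> set T = {}) \<mu> \<and>
              (\<Union>S\<in>\<mu>. set S) = {..<n}}"

definition block :: "nat list set \<Rightarrow> nat \<Rightarrow> nat set" where
  "block \<mu> l = {S ! (l mod length S) |S. S \<in> \<mu>}"

definition phi :: "nat list set \<Rightarrow> nat set list" where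
  "phi \<mu> = map (block \<mu>) [0..<(LCM S\<in>\<mu>. length S)]"

text \<open>
  The element at position \<open>0\<close> moves to position \<open>i\<close> (modulo the length). This is the
  opposite direction of the list function \<^const>\<open>rotate\<close>.
\<close>

definition circ_shift :: "int \<Rightarrow> 'b list \<Rightarrow> 'b list" where
  "circ_shift i xs = map (\<lambda>j. xs ! nat ((int j - i) mod int (length xs))) [0..<length xs]"

definition equiv_star :: "nat list set \<Rightarrow> nat list set \<Rightarrow> bool" (infix "\<equiv>\<^sub>\<star>" 50) where
  "\<mu> \<equiv>\<^sub>\<star> \<mu>' \<longleftrightarrow> (\<exists>i<length (phi \<mu>'). phi \<mu> = circ_shift (int i) (phi \<mu>'))"


section \<open>Automata networks\<close>

text \<open>
  The alphabets are \<open>A 0, \<dots>, A (n - 1)\<close>; a configuration is an extensional function on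
  \<open>{..<n}\<close>. Values of a network outside the configuration space are irrelevant.
\<close>

definition configs :: "nat \<Rightarrow> (nat \<Rightarrow> 'a set) \<Rightarrow> (nat \<Rightarrow> 'a) set" where
  "configs n A = (\<Pi>\<^sub>E i\<in>{..<n}. A i)"

definition automata_network ::
    "nat \<Rightarrow> (nat \<Rightarrow> 'a set) \<Rightarrow> ((nat \<Rightarrow> 'a) \<Rightarrow> (nat \<Rightarrow> 'a)) \<Rightarrow> bool" where
  "automata_network n A f \<longleftrightarrow>
     (\<forall>i<n. finite (A i) \<and> A i \<noteq> {}) \<and> f \<in> configs n A \<rightarrow> configs n A"

definition block_update ::
    "((nat \<Rightarrow> 'a) \<Rightarrow> (nat \<Rightarrow> 'a)) \<Rightarrow> nat set \<Rightarrow> (nat \<Rightarrow> 'a) \<Rightarrow> (nat \<Rightarrow> 'a)" where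
  "block_update f W x = (\<lambda>i. if i \<in> W then f x i else x i)"

definition update ::
    "((nat \<Rightarrow> 'a) \<Rightarrow> (nat \<Rightarrow> 'a)) \<Rightarrow> nat list set \<Rightarrow> (nat \<Rightarrow> 'a) \<Rightarrow> (nat \<Rightarrow> 'a)" where
  "update f \<mu> = fold (block_update f) (phi \<mu>)"


section \<open>Limit dynamics\<close>

definition limit_set :: "'c set \<Rightarrow> ('c \<Rightarrow> 'c) \<Rightarrow> 'c set" where
  "limit_set X g = (\<Inter>t. (g ^^ t) ` X)"

definition limit_dynamics :: "'c set \<Rightarrow> ('c \<Rightarrow> 'c) \<Rightarrow> 'c \<Rightarrow> 'c" where
  "limit_dynamics X g = restrict g (limit_set X g)"

text \<open>Isomorphism of the functional digraphs of \<open>g : A \<rightarrow> A\<close> and \<open>h : B \<rightarrow> B\<close>.\<close>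

definition dyn_iso :: "'c set \<Rightarrow> ('c \<Rightarrow> 'c) \<Rightarrow> 'd set \<Rightarrow> ('d \<Rightarrow> 'd) \<Rightarrow> bool" where
  "dyn_iso A g B h \<longleftrightarrow>
     (\<exists>\<pi>. bij_betw \<pi> A B \<and> (\<forall>x\<in>A. \<forall>y\<in>A. g x = y \<longleftrightarrow> h (\<pi> x) = \<pi> y))"

text \<open>
  The limit dynamics of \<open>f\<close> on the configuration space \<open>X\<close> under \<open>\<mu>\<close> and under \<open>\<mu>'\<close>
  are isomorphic.
\<close>

definition same_limit_dynamics ::
    "(nat \<Rightarrow> 'a) set \<Rightarrow> ((nat \<Rightarrow> 'a) \<Rightarrow> (nat \<Rightarrow> 'a)) \<Rightarrow> nat list set \<Rightarrow> nat list set \<Rightarrow> bool" where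
  "same_limit_dynamics X f \<mu> \<mu>' \<longleftrightarrow>
     dyn_iso (limit_set X (update f \<mu>)) (limit_dynamics X (update f \<mu>))
             (limit_set X (update f \<mu>')) (limit_dynamics X (update f \<mu>'))"

end

theory Submission
  imports Defs
begin

text \<open>
  If \<open>\<phi>(\<mu>)\<close> is a shift of \<open>\<phi>(\<mu>')\<close>, the two updates are of the form \<open>a \<circ> b\<close> and \<open>b \<circ> a\<close>, and \<open>b\<close>
  conjugates their limit dynamics.

  Conversely, extend \<open>\<phi>(\<mu>)\<close> to a \<open>p\<close>-periodic sequence \<open>W\<close> of blocks and let the configuration at
  time \<open>l\<close> record for each automaton the time of its last update along \<open>W\<close>, modulo \<open>2p\<close>. The
  network computes the next such configuration when exactly \<open>W l\<close> is updated; updating any other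
  block leads outside the set of these configurations, and from there to a fixed point \<open>\<bottom>\<close> that
  is reached for good. Along \<open>W\<close> itself the limit set contains \<open>\<bottom>\<close> and a time-stamp
  configuration; along a sequence that is not a shift of \<open>W\<close> it is contained in \<open>{\<bottom>}\<close>.
  Finally, the blocks of \<open>\<phi>(\<mu>)\<close> are pairwise distinct, so that \<open>p\<close> is the exact period and
  a shift between the periodic extensions is a circular shift of the finite sequences.
\<close>

section \<open>Limit sets\<close>

lemma funpow_image_subset:
  assumes "g ` X \<subseteq> X" shows "(g ^^ t) ` X \<subseteq> X"
  by (induction t) (use assms in auto)

lemma image_limit_set:
  assumes fin: "finite X" and g: "g ` X \<subseteq> X"
  shows "g ` limit_set X g = limit_set X g"
proof -
  let ?I = "\<lambda>t. (g ^^ t) ` X"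
  have anti: "?I t \<subseteq> ?I s" if "s \<le> t" for s t
  proof -
    have "?I t = (g ^^ s) ` ?I (t - s)"
      using that by (simp add: image_comp flip: funpow_add)
    then show ?thesis
      using funpow_image_subset[OF g] by (metis image_mono)
  qed
  \<comment> \<open>An image of least cardinality. By finiteness and \<open>anti\<close> all later
    images equal it, so the limit set is this single image.\<close>
  obtain T where T: "\<And>t. card (?I T) \<le> card (?I t)"
    using ex_has_least_nat[of "\<lambda>_. True" 0 "\<lambda>t. card (?I t)"] by auto
  have stable: "?I t = ?I T" if "T \<le> t" for t
    by (intro card_seteq anti that T finite_imageI fin)
  have L: "limit_set X g = ?I T"
    unfolding limit_set_def
  proof (intro antisym INT_greatest)
    show "?I T \<subseteq> ?I t" for t
      using anti[of t "max t T"] stable[of "max t T"] by simp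
  qed blast
  have "g ` ?I T = ?I (Suc T)" by (simp add: image_comp)
  then show ?thesis using stable[of "Suc T"] L by simp
qed

lemma limit_set_subset: "limit_set X g \<subseteq> X"
proof -
  have "limit_set X g \<subseteq> (g ^^ 0) ` X" unfolding limit_set_def by (rule INT_lower) simp
  then show ?thesis by simp
qed

text \<open>A map of a finite set onto itself is injective.\<close>

lemma inj_on_limit_set:
  assumes "finite X" and "g ` X \<subseteq> X"
  shows "inj_on g (limit_set X g)"
  using image_limit_set[OF assms] limit_set_subset[of X g] assms(1)
  by (metis finite_subset eq_card_imp_inj_on)

lemma image_limit_set_comp_subset:
  assumes b: "b ` X \<subseteq> X"
  shows "b ` limit_set X (a \<circ> b) \<subseteq> limit_set X (b \<circ> a)"
proof -
  have *: "b (((a \<circ> b) ^^ t) x) = ((b \<circ> a) ^^ t) (b x)" for t x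
    by (induction t) auto
  show ?thesis
  proof (rule image_subsetI)
    fix y assume y: "y \<in> limit_set X (a \<circ> b)"
    show "b y \<in> limit_set X (b \<circ> a)"
      unfolding limit_set_def
    proof
      fix t
      obtain x where "x \<in> X" "y = ((a \<circ> b) ^^ t) x"
        using y unfolding limit_set_def by blast
      then show "b y \<in> ((b \<circ> a) ^^ t) ` X" using * b by auto
    qed
  qed
qed

text \<open>The isomorphism is \<open>b\<close>. It is injective because \<open>a \<circ> b\<close>
  is injective on its limit set, and onto because \<open>b \<circ> a\<close> maps its limit set onto
  itself.\<close>

lemma dyn_iso_limit_dynamics_comp:
  assumes fin: "finite X" and a: "a ` X \<subseteq> X" and b: "b ` X \<subseteq> X"
  shows "dyn_iso (limit_set X (a \<circ> b)) (limit_dynamics X (a \<circ> b))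
                 (limit_set X (b \<circ> a)) (limit_dynamics X (b \<circ> a))"
proof -
  let ?A = "limit_set X (a \<circ> b)" and ?B = "limit_set X (b \<circ> a)"
  have ab: "(a \<circ> b) ` X \<subseteq> X" and ba: "(b \<circ> a) ` X \<subseteq> X" using a b by auto
  have sub: "b ` ?A \<subseteq> ?B" "a ` ?B \<subseteq> ?A"
    by (intro image_limit_set_comp_subset a b)+
  have inj: "inj_on b ?A"
    using inj_on_limit_set[OF fin ab] by (rule inj_on_imageI2)
  have "?B = b ` a ` ?B"
    using image_limit_set[OF fin ba] by (simp add: image_comp)
  then have "?B \<subseteq> b ` ?A" using sub(2) by blast
  then have "bij_betw b ?A ?B"
    using inj sub(1) by (auto simp: bij_betw_def)
  moreover have "limit_dynamics X (a \<circ> b) x = y \<longleftrightarrow> limit_dynamics X (b \<circ> a) (b x) = b y"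
    if "x \<in> ?A" "y \<in> ?A" for x y
  proof -
    have "a (b x) \<in> ?A" using that(1) sub by blast
    moreover have "b x \<in> ?B" using that(1) sub by blast
    ultimately show ?thesis
      using that inj by (simp add: limit_dynamics_def inj_on_eq_iff)
  qed
  ultimately show ?thesis unfolding dyn_iso_def by blast
qed

section \<open>Updates on configurations, and circular shifts as rotations\<close>

lemma block_update_configs:
  assumes "automata_network n A f" "x \<in> configs n A"
  shows "block_update f W x \<in> configs n A"
proof -
  have "f x \<in> configs n A" using assms by (auto simp: automata_network_def)
  then show ?thesis
    using assms(2) by (auto simp: block_update_def configs_def PiE_iff extensional_def)
qed

lemma fold_block_update_configs:
  assumes "automata_network n A f" "x \<in> configs n A"
  shows "fold (block_update f) Ws x \<in> configs n A"
  using assms(2) by (induction Ws arbitrary: x) (auto intro: block_update_configs assms(1))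

lemma finite_configs:
  assumes "automata_network n A f"
  shows "finite (configs n A)"
  using assms by (auto simp: automata_network_def configs_def intro: finite_PiE)

text \<open>Elements move to the right, so the last \<open>i\<close> of them come to the
  front.\<close>

lemma circ_shift_eq_append:
  assumes "i < length xs"
  shows "circ_shift (int i) xs = drop (length xs - i) xs @ take (length xs - i) xs"
proof (rule nth_equalityI)
  fix j assume "j < length (circ_shift (int i) xs)"
  then have j: "j < length xs" by (simp add: circ_shift_def)
  have "(int j - int i) mod int (length xs) = (if j < i then int j - int i + int (length xs) else int j - int i)"
  proof (cases "j < i")
    case True
    have "(int j - int i) mod int (length xs) = (int j - int i + int (length xs)) mod int (length xs)"
      by simp
    also have "\<dots> = int j - int i + int (length xs)"
      using True j assms by (intro mod_pos_pos_trivial) auto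
    finally show ?thesis using True by simp
  qed (use j in simp)
  then have "nat ((int j - int i) mod int (length xs)) = (if j < i then length xs - i + j else j - i)"
    using assms by auto
  then show "circ_shift (int i) xs ! j = (drop (length xs - i) xs @ take (length xs - i) xs) ! j"
    using j assms by (auto simp: circ_shift_def nth_append)
qed (use assms in \<open>simp add: circ_shift_def\<close>)

lemma equiv_star_imp_same_limit_dynamics:
  assumes "\<mu> \<equiv>\<^sub>\<star> \<mu>'" and net: "automata_network n A f"
  shows "same_limit_dynamics (configs n A) f \<mu> \<mu>'"
proof -
  obtain i where "i < length (phi \<mu>')" "phi \<mu> = circ_shift (int i) (phi \<mu>')"
    using assms(1) by (auto simp: equiv_star_def)
  then have "\<exists>us vs. phi \<mu> = vs @ us \<and> phi \<mu>' = us @ vs"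
    by (metis circ_shift_eq_append append_take_drop_id)
  then obtain us vs where uv: "phi \<mu> = vs @ us" "phi \<mu>' = us @ vs" by blast
  have "update f \<mu> = fold (block_update f) us \<circ> fold (block_update f) vs"
       "update f \<mu>' = fold (block_update f) vs \<circ> fold (block_update f) us"
    by (simp_all add: update_def uv)
  then show ?thesis
    unfolding same_limit_dynamics_def
    using fold_block_update_configs[OF net]
    by (auto intro!: dyn_iso_limit_dynamics_comp finite_configs[OF net])
qed

section \<open>Periodic block sequences\<close>

abbreviation run ::
    "((nat \<Rightarrow> 'a) \<Rightarrow> (nat \<Rightarrow> 'a)) \<Rightarrow> (nat \<Rightarrow> nat set) \<Rightarrow> nat \<Rightarrow> (nat \<Rightarrow> 'a) \<Rightarrow> (nat \<Rightarrow> 'a)" where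
  "run f V t \<equiv> fold (block_update f) (map V [0..<t])"

lemma update_eq_run: "update f \<mu> = run f (block \<mu>) (LCM S\<in>\<mu>. length S)"
  by (simp add: update_def phi_def)

text \<open>The absolute difference turns congruence into divisibility whatever the order of
  \<open>a\<close> and \<open>b\<close>, which suits the divisibility criterion for an
  \<open>LCM\<close>.\<close>

lemma nat_mod_eq_iff_dvd_diff:
  fixes a b m :: nat
  shows "a mod m = b mod m \<longleftrightarrow> m dvd nat \<bar>int a - int b\<bar>"
proof -
  have "a mod m = b mod m \<longleftrightarrow> int a mod int m = int b mod int m"
    by (metis of_nat_mod of_nat_eq_iff)
  also have "\<dots> \<longleftrightarrow> int m dvd int a - int b" by (rule mod_eq_dvd_iff)
  also have "\<dots> \<longleftrightarrow> m dvd nat \<bar>int a - int b\<bar>" by simp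
  finally show ?thesis .
qed

text \<open>Any \<open>m\<close> consecutive numbers represent every residue;
  \<open>mod_neq_if_close\<close> gives uniqueness of the representative.\<close>

lemma ex_mod_eq_window:
  fixes m :: nat assumes "0 < m" shows "\<exists>k\<ge>s. k < s + m \<and> k mod m = j mod m"
proof (induction s)
  case 0
  show ?case using assms by (intro exI[of _ "j mod m"]) auto
next
  case (Suc s)
  then obtain k where k: "s \<le> k" "k < s + m" "k mod m = j mod m" by blast
  then show ?case using assms
    by (cases "k = s") (auto intro: exI[of _ "s + m"] exI[of _ k])
qed

lemma mod_neq_if_close:
  fixes a b m :: nat assumes "a < b" "b < a + m" shows "a mod m \<noteq> b mod m"
  using assms by (metis le_add_diff_inverse less_imp_le_nat mod_eq_dvd_iff_nat
      nat_dvd_not_less zero_less_diff add_less_cancel_left)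

text \<open>Models the infinite periodic extension of \<open>phi\<close>, so that times can be
  counted without reduction. Here \<open>p\<close> is some period; that it is the least one for a
  partitioned order follows from \<open>block_eq_iff\<close>.\<close>

locale periodic_blocks =
  fixes n p :: nat and W :: "nat \<Rightarrow> nat set"
  assumes period_pos: "0 < p"
    and periodic: "W (t + p) = W t"
    and block_nonempty: "W t \<noteq> {}"
    and block_subset: "W t \<subseteq> {..<n}"
    and block_cover: "i < n \<Longrightarrow> \<exists>t<p. i \<in> W t"
begin

lemma periodic_mult: "W (t + k * p) = W t"
proof (induction k)
  case (Suc k)
  have "t + Suc k * p = (t + k * p) + p" by simp
  then show ?case using Suc by (simp only: periodic)
qed simp

lemma periodic_mod: "W (t mod p) = W t"
  using periodic_mult[of "t mod p" "t div p"] by simp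

lemma block_cover_window:
  assumes "i < n" shows "\<exists>t\<ge>s. t < s + p \<and> i \<in> W t"
proof (induction s)
  case 0
  then show ?case using block_cover[OF assms] by auto
next
  case (Suc s)
  then obtain t where t: "s \<le> t" "t < s + p" "i \<in> W t" by blast
  show ?case
  proof (cases "t = s")
    case True
    then show ?thesis using t period_pos periodic by (intro exI[of _ "s + p"]) auto
  next
    case False
    then show ?thesis using t by (intro exI[of _ t]) auto
  qed
qed

lemma run_funpow: "(run f W p ^^ k) x = run f W (k * p) x"
proof -
  have *: "run f W (k * p + t) x = run f W t (run f W (k * p) x)" for k t
  proof (induction t)
    case (Suc t)
    have "W (k * p + t) = W t" by (metis periodic_mult add.commute)
    then show ?case using Suc by simp
  qed simp
  show ?thesis
  proof (induction k)
    case (Suc k)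
    have "Suc k * p = k * p + p" by simp
    then show ?case using Suc * by (simp only: funpow.simps o_apply)
  qed simp
qed

section \<open>Times of last update and their residues\<close>

definition last_update :: "nat \<Rightarrow> nat \<Rightarrow> nat" where
  "last_update l i = Max {t. t < l \<and> i \<in> W t}"

lemma last_update_ge:
  assumes "t < l" "i \<in> W t" shows "t \<le> last_update l i"
  using assms by (simp add: last_update_def)

text \<open>A full period fits before time \<open>l\<close>, so the set whose \<open>Max\<close> is
  taken is nonempty and meets the last \<open>p\<close> steps.\<close>

lemma
  assumes "i < n" "p \<le> l"
  shows last_update_less: "last_update l i < l"
    and last_update_mem: "i \<in> W (last_update l i)"
    and last_update_window: "l \<le> last_update l i + p"
proof -
  obtain t where t: "l - p \<le> t" "t < l - p + p" "i \<in> W t"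
    using block_cover_window[OF assms(1)] by blast
  then have "last_update l i \<in> {t. t < l \<and> i \<in> W t}"
    unfolding last_update_def using assms(2) by (intro Max_in) auto
  then show "last_update l i < l" "i \<in> W (last_update l i)" by auto
  show "l \<le> last_update l i + p" using last_update_ge[of t l i] t assms(2) by auto
qed

lemma last_update_Suc:
  assumes "i < n" "p \<le> l"
  shows "last_update (Suc l) i = (if i \<in> W l then l else last_update l i)"
proof (cases "i \<in> W l")
  case True
  then show ?thesis
    using last_update_ge[of l "Suc l" i] last_update_less[of i "Suc l"] assms by simp
next
  case False
  then have "{t. t < Suc l \<and> i \<in> W t} = {t. t < l \<and> i \<in> W t}" by (auto simp: less_Suc_eq)
  then show ?thesis using False by (simp add: last_update_def)
qed

lemma last_update_add_period:
  assumes "i < n" "p \<le> l"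
  shows "last_update (l + p) i = last_update l i + p"
proof (rule antisym)
  let ?t = "last_update (l + p) i"
  have t: "?t < l + p" "i \<in> W ?t" "l + p \<le> ?t + p"
    using assms last_update_window[of i "l + p"]
    by (auto intro!: last_update_less last_update_mem)
  then have "?t - p \<le> last_update l i"
    using assms(2) periodic[of "?t - p"] by (intro last_update_ge) auto
  then show "?t \<le> last_update l i + p" by simp
  show "last_update l i + p \<le> ?t"
    using assms last_update_less last_update_mem by (intro last_update_ge) (auto simp: periodic)
qed

text \<open>
  The modulus is \<open>2p\<close> rather than \<open>p\<close> because an automaton that is updated once per period must
  see its stamp change.
\<close>

definition stamp :: "nat \<Rightarrow> nat \<Rightarrow> nat" where
  "stamp l i = last_update l i mod (2 * p)"

text \<open>Moving the time by \<open>2p\<close> moves every last update by \<open>2p\<close>, so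
  stamps depend only on the residue of the time.\<close>

lemma stamp_cong:
  assumes "i < n" "p \<le> l" "p \<le> j" "l mod (2 * p) = j mod (2 * p)"
  shows "stamp l i = stamp j i"
proof -
  have add: "stamp (l + k * (2 * p)) i = stamp l i" if "p \<le> l" for k l
  proof (induction k)
    case (Suc k)
    let ?l = "l + k * (2 * p)"
    have "last_update (?l + p + p) i = last_update ?l i + p + p"
      using assms(1) that by (simp only: last_update_add_period trans_le_add1)
    moreover have "?l + p + p = l + Suc k * (2 * p)" by simp
    ultimately have "last_update (l + Suc k * (2 * p)) i = last_update ?l i + 2 * p" by simp
    then show ?case using Suc by (simp add: stamp_def)
  qed simp
  have "stamp l i = stamp j i" if "p \<le> l" "l \<le> j" "l mod (2 * p) = j mod (2 * p)" for l j
  proof -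
    have "j = l + (j - l) div (2 * p) * (2 * p)"
      using that by (metis dvd_div_mult_self le_add_diff_inverse mod_eq_dvd_iff_nat)
    then show ?thesis using add[OF that(1)] by metis
  qed
  then show ?thesis using assms by (metis nat_le_linear)
qed

text \<open>Advancing the stamps of a nonempty proper part of \<open>W l\<close> never yields the
  stamps of any time \<open>j\<close>. The proof replaces \<open>j\<close> by its representative
  \<open>k\<close> in the window of length \<open>2p\<close> that starts at \<open>Suc l\<close>,
  where congruent update times that are close must coincide.\<close>

lemma partial_update_stamp:
  assumes l: "p \<le> l" and j: "p \<le> j" and D: "D \<subseteq> W l" "D \<noteq> {}"
    and eq: "\<And>i. i < n \<Longrightarrow> stamp j i = (if i \<in> D then stamp (Suc l) i else stamp l i)"
  shows "D = W l \<and> j mod (2 * p) = Suc l mod (2 * p)"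
proof -
  obtain k where k: "Suc l \<le> k" "k < Suc l + 2 * p" "k mod (2 * p) = j mod (2 * p)"
    using ex_mod_eq_window[of "2 * p" "Suc l" j] period_pos by auto
  have kp: "p \<le> k" using k l by simp
  have eq': "last_update k i mod (2 * p) =
      (if i \<in> D then last_update (Suc l) i else last_update l i) mod (2 * p)" if "i < n" for i
    using eq[OF that] stamp_cong[OF that kp j k(3)] by (simp add: stamp_def)
  note window = last_update_window[OF _ kp] last_update_less[OF _ kp]
  \<comment> \<open>An automaton of \<open>D\<close> bears the stamp of \<open>l\<close>, and its
    last update before \<open>k\<close> is less than \<open>2p\<close> after \<open>l\<close>, hence
    equal to \<open>l\<close>. No automaton waits longer than \<open>p\<close>, which bounds
    \<open>k\<close>.\<close>
  have k_le: "k \<le> l + p"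
  proof -
    obtain i where i: "i \<in> D" "i < n" using D block_subset by blast
    then have "last_update k i mod (2 * p) = l mod (2 * p)"
      using eq' D l by (auto simp: last_update_Suc)
    moreover have "last_update k i < l + 2 * p" "l \<le> last_update k i"
      using window[OF i(2)] k i(1) D(1) by (auto intro: last_update_ge)
    ultimately have "last_update k i = l"
      using mod_neq_if_close[of l "last_update k i" "2 * p"] by fastforce
    then show ?thesis using window[OF i(2)] by simp
  qed
  \<comment> \<open>For an automaton of \<open>W l\<close> left out of \<open>D\<close>, the last
    update would move from before \<open>l\<close> to \<open>l\<close> or later, by less than
    \<open>2p\<close>, so its stamp could not be unchanged.\<close>
  have "W l \<subseteq> D"
  proof (rule ccontr)
    assume "\<not> W l \<subseteq> D"
    then obtain i where i: "i \<in> W l" "i \<notin> D" by blast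
    then have "i < n" using block_subset by blast
    have "last_update l i < last_update k i"
      using last_update_less[OF \<open>i < n\<close> l] last_update_ge[of l k i] i k by simp
    moreover have "last_update k i < last_update l i + 2 * p"
      using window[OF \<open>i < n\<close>] k_le last_update_window[OF \<open>i < n\<close> l] by simp
    ultimately show False using mod_neq_if_close eq'[OF \<open>i < n\<close>] i by (metis (full_types))
  qed
  then have DW: "D = W l" using D by blast
  have "k = Suc l"
  proof (rule ccontr)
    assume "k \<noteq> Suc l"
    then have kl: "Suc l \<le> k - 1" using k by simp
    \<comment> \<open>At time \<open>k\<close> such an automaton bears the stamp of
      \<open>k - 1\<close>, whereas at time \<open>Suc l\<close> its last update is earlier by less
      than \<open>2p\<close>.\<close>
    obtain i where i: "i \<in> W (k - 1)" using block_nonempty by blast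
    then have "i < n" using block_subset by blast
    have ki: "last_update k i = k - 1"
      using last_update_ge[of "k - 1" k i] window[OF \<open>i < n\<close>] i k by simp
    have "last_update k i mod (2 * p) = last_update (Suc l) i mod (2 * p)"
      using eq'[OF \<open>i < n\<close>] l \<open>i < n\<close> DW by (auto simp: last_update_Suc)
    moreover have "last_update (Suc l) i < k - 1"
      using last_update_less[OF \<open>i < n\<close>, of "Suc l"] l kl by simp
    moreover have "k - 1 < last_update (Suc l) i + 2 * p"
      using last_update_window[OF \<open>i < n\<close>, of "Suc l"] l k_le period_pos by simp
    ultimately show False using mod_neq_if_close ki by metis
  qed
  then show ?thesis using DW k by simp
qed

lemma stamp_inj:
  assumes "p \<le> l" "p \<le> j" and eq: "\<And>i. i < n \<Longrightarrow> stamp l i = stamp j i"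
  shows "l mod (2 * p) = j mod (2 * p)"
proof -
  \<comment> \<open>The predecessor of \<open>l\<close>, raised by one modulus so that
    \<open>p \<le> l'\<close> even when \<open>l = p\<close>. The full block \<open>W l'\<close>
    then serves as \<open>D\<close> in \<open>partial_update_stamp\<close>.\<close>
  define l' where "l' = l + 2 * p - 1"
  have l': "p \<le> l'" "Suc l' = l + 2 * p" using assms(1) period_pos by (auto simp: l'_def)
  have "stamp j i = (if i \<in> W l' then stamp (Suc l') i else stamp l' i)" if "i < n" for i
  proof -
    have "stamp j i = stamp (Suc l') i"
      using eq[OF that] stamp_cong[OF that, of l "Suc l'"] assms(1) l' by simp
    then show ?thesis using l'(1) that by (simp add: stamp_def last_update_Suc)
  qed
  then have "j mod (2 * p) = Suc l' mod (2 * p)"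
    using partial_update_stamp[OF l'(1) assms(2) order_refl block_nonempty] by blast
  then show ?thesis using l' by simp
qed

end

section \<open>The time-stamp network\<close>

locale stamp_network = periodic_blocks +
  fixes e :: "nat \<Rightarrow> 'a"
  assumes inj_e: "inj e"
begin

definition err :: "nat \<Rightarrow> 'a" where
  "err = (\<lambda>i\<in>{..<n}. e (2 * p))"

definition conf :: "nat \<Rightarrow> nat \<Rightarrow> 'a" where
  "conf l = (\<lambda>i\<in>{..<n}. e (stamp l i))"

definition alphabet :: "nat \<Rightarrow> 'a set" where
  "alphabet i = e ` {..2 * p}"

text \<open>The chosen \<open>l\<close> is determined only modulo \<open>2p\<close>, which suffices
  for both the block and the value written. Automata outside \<open>W l\<close> are offered
  \<open>e (2 * p)\<close>, a symbol that no stamp uses, so that updating one of them is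
  detected.\<close>

definition net :: "(nat \<Rightarrow> 'a) \<Rightarrow> nat \<Rightarrow> 'a" where
  "net x = (if \<exists>l\<ge>p. x = conf l
            then let l = (SOME l. p \<le> l \<and> x = conf l)
                 in (\<lambda>i\<in>{..<n}. if i \<in> W l then e (l mod (2 * p)) else e (2 * p))
            else err)"

lemma stamp_less: "stamp l i < 2 * p"
  using period_pos by (simp add: stamp_def)

lemma conf_eq_iff:
  assumes "p \<le> l" "p \<le> j"
  shows "conf l = conf j \<longleftrightarrow> l mod (2 * p) = j mod (2 * p)"
proof
  assume eq: "conf l = conf j"
  show "l mod (2 * p) = j mod (2 * p)"
  proof (rule stamp_inj[OF assms])
    fix i assume "i < n"
    then show "stamp l i = stamp j i"
      using fun_cong[OF eq, of i] inj_e by (simp add: conf_def inj_eq)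
  qed
next
  assume "l mod (2 * p) = j mod (2 * p)"
  then have "stamp l i = stamp j i" if "i < n" for i using stamp_cong assms that by blast
  then show "conf l = conf j" by (auto simp: conf_def restrict_def)
qed

lemma net_conf:
  assumes "p \<le> l"
  shows "net (conf l) = (\<lambda>i\<in>{..<n}. if i \<in> W l then e (l mod (2 * p)) else e (2 * p))"
proof -
  define j where "j = (SOME j. p \<le> j \<and> conf l = conf j)"
  have j: "p \<le> j \<and> conf l = conf j"
    unfolding j_def by (rule someI[of _ l]) (use assms in simp)
  then have jl: "l mod (2 * p) = j mod (2 * p)" using assms conf_eq_iff by blast
  then have "l mod p = j mod p" by (metis mod_mod_cancel dvd_triv_right)
  then have "W l = W j" by (metis periodic_mod)
  then show ?thesis using assms jl by (auto simp: net_def Let_def simp flip: j_def)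
qed

lemma net_other: "(\<And>l. p \<le> l \<Longrightarrow> x \<noteq> conf l) \<Longrightarrow> net x = err"
  by (auto simp: net_def)

lemma conf_nth_neq: "i < n \<Longrightarrow> conf l i \<noteq> e (2 * p)"
  using stamp_less[of l i] inj_e by (auto simp: conf_def inj_eq)

lemma conf_in_configs: "conf l \<in> configs n alphabet"
  using stamp_less by (auto simp: configs_def conf_def alphabet_def intro!: imageI less_imp_le)

lemma err_in_configs: "err \<in> configs n alphabet"
  by (auto simp: configs_def err_def alphabet_def)

lemma automata_network_net: "automata_network n alphabet net"
  unfolding automata_network_def
proof (intro conjI allI impI)
  show "net \<in> configs n alphabet \<rightarrow> configs n alphabet"
  proof
    fix x
    show "net x \<in> configs n alphabet"
    proof (cases "\<exists>l\<ge>p. x = conf l")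
      case True
      then obtain l where "p \<le> l" "x = conf l" by blast
      moreover have "l mod (2 * p) \<le> 2 * p" using period_pos by (simp add: less_imp_le)
      ultimately show ?thesis by (auto simp: net_conf configs_def alphabet_def)
    next
      case False
      then show ?thesis using err_in_configs net_other by metis
    qed
  qed
qed (auto simp: alphabet_def)

lemma n_pos: "0 < n"
  using block_nonempty[of 0] block_subset[of 0] by auto

lemma conf_neq_err: "conf l \<noteq> err"
  using conf_nth_neq[OF n_pos] n_pos by (auto simp: err_def dest: fun_cong[of _ _ 0])

lemma net_err: "net err = err"
  using conf_neq_err by (metis net_other)

text \<open>The automata of \<open>W l\<close> receive the residue of \<open>l\<close>, now their
  last update; all other last updates stay.\<close>

lemma block_update_conf:
  assumes "p \<le> l"
  shows "block_update net (W l) (conf l) = conf (Suc l)"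
proof
  fix i
  show "block_update net (W l) (conf l) i = conf (Suc l) i"
    using assms block_subset[of l]
    by (cases "i < n")
      (auto simp: block_update_def net_conf, auto simp: conf_def stamp_def last_update_Suc)
qed

text \<open>The error symbol excludes automata outside \<open>W l\<close>, and
  \<open>partial_update_stamp\<close> excludes a proper part of \<open>W l\<close>.\<close>

lemma block_update_wrong_block:
  assumes "p \<le> l" "U \<subseteq> {..<n}" "U \<noteq> {}" "block_update net U (conf l) = conf j" "p \<le> j"
  shows "U = W l"
proof -
  have upd: "conf j i = (if i \<in> U then if i \<in> W l then e (l mod (2 * p)) else e (2 * p) else conf l i)"
    if "i < n" for i
    using fun_cong[OF assms(4), of i] that assms(1) by (auto simp: block_update_def net_conf)
  then have sub: "U \<subseteq> W l" using conf_nth_neq assms(2) by (metis lessThan_iff subsetD subsetI)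
  have "stamp j i = (if i \<in> U then stamp (Suc l) i else stamp l i)" if "i < n" for i
    using upd[OF that] that sub assms(1) inj_e
    by (auto simp: conf_def stamp_def last_update_Suc inj_eq split: if_splits)
  then show ?thesis using partial_update_stamp[OF assms(1,5) sub assms(3)] by blast
qed

section \<open>Limit sets along \<open>W\<close> and along other block sequences\<close>

lemma conf_in_limit_set: "conf p \<in> limit_set (configs n alphabet) (run net W p)"
  unfolding limit_set_def
proof
  fix t
  have "run net W s (conf (k * p)) = conf (k * p + s)" if "0 < k" for s k
  proof (induction s)
    case (Suc s)
    have "W s = W (k * p + s)" by (metis periodic_mult add.commute)
    moreover have "p \<le> k * p + s" using that by (simp add: trans_le_add1)
    ultimately show ?case using Suc block_update_conf[of "k * p + s"] by simp
  qed simp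
  \<comment> \<open>Starting at time \<open>Suc t * p\<close>, \<open>t\<close> periods lead to time
    \<open>(2t + 1) p\<close>, which is \<open>p\<close> modulo \<open>2p\<close>; this gives a
    preimage of \<open>conf p\<close> for each \<open>t\<close>.\<close>
  then have "(run net W p ^^ t) (conf (Suc t * p)) = conf (Suc t * p + t * p)"
    by (simp add: run_funpow del: mult_Suc)
  also have "\<dots> = conf p"
  proof (subst conf_eq_iff)
    have "Suc t * p + t * p = p + t * (2 * p)" by simp
    then show "(Suc t * p + t * p) mod (2 * p) = p mod (2 * p)" by (simp only: mod_mult_self1)
  qed auto
  finally show "conf p \<in> (run net W p ^^ t) ` configs n alphabet"
    using conf_in_configs by (metis imageI)
qed

lemma err_in_limit_set: "err \<in> limit_set (configs n alphabet) (run net V q)"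
proof -
  have "block_update net U err = err" for U
    by (auto simp: block_update_def net_err)
  then have "fold (block_update net) Us err = err" for Us by (induction Us) auto
  then have "(run net V q ^^ t) err = err" for t by (induction t) (auto)
  then have "err \<in> (run net V q ^^ t) ` configs n alphabet" for t
    using err_in_configs by (metis imageI)
  then show ?thesis unfolding limit_set_def by blast
qed

lemma run_in_configs: "x \<in> configs n alphabet \<Longrightarrow> run net V t x \<in> configs n alphabet"
  by (rule fold_block_update_configs[OF automata_network_net])

text \<open>Off the time-stamp configurations every update writes the error symbol, which prevents a
  return to them; within \<open>q\<close> steps every automaton has been updated.\<close>

lemma run_reaches_err:
  assumes V: "periodic_blocks n q V" and x: "x \<in> configs n alphabet"
    and out: "\<And>l. p \<le> l \<Longrightarrow> run net V t x \<noteq> conf l" and s: "t + q \<le> s"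
  shows "run net V s x = err"
proof -
  interpret V: periodic_blocks n q V by fact
  have stay: "(\<forall>l\<ge>p. run net V (t + d) x \<noteq> conf l) \<and>
      (\<forall>i<n. (\<exists>r\<ge>t. r < t + d \<and> i \<in> V r) \<longrightarrow> run net V (t + d) x i = e (2 * p))" for d
  proof (induction d)
    case 0
    show ?case using out by auto
  next
    case (Suc d)
    let ?y = "run net V (t + d) x"
    have step: "run net V (t + Suc d) x = block_update net (V (t + d)) ?y" by simp
    have "net ?y = err" using Suc by (intro net_other) blast
    then have val: "run net V (t + Suc d) x i = (if i \<in> V (t + d) then e (2 * p) else ?y i)"
      if "i < n" for i
      using that by (simp only: step) (simp add: block_update_def err_def)
    obtain i where i: "i \<in> V (t + d)" using V.block_nonempty by blast
    then have "i < n" using V.block_subset by blast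
    then have "run net V (t + Suc d) x i = e (2 * p)" using val i by simp
    then have "run net V (t + Suc d) x \<noteq> conf l" for l
      using conf_nth_neq[OF \<open>i < n\<close>] by metis
    moreover have "run net V (t + Suc d) x i = e (2 * p)"
      if "i < n" "r \<ge> t" "r < t + Suc d" "i \<in> V r" for i r
    proof (cases "i \<in> V (t + d)")
      case False
      then have "r < t + d" using that by (metis add_Suc_right less_SucE)
      then show ?thesis using val[OF that(1)] False Suc that by auto
    qed (use val that in simp)
    ultimately show ?case by blast
  qed
  have "run net V s x i = err i" for i
  proof (cases "i < n")
    case True
    then obtain r where "r \<ge> t" "r < t + q" "i \<in> V r" using V.block_cover_window by blast
    then show ?thesis using stay[of "s - t"] s True by (auto simp: err_def)
  next
    case False
    then show ?thesis using run_in_configs[OF x, of V s]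
      by (auto simp: configs_def PiE_iff extensional_def err_def)
  qed
  then show ?thesis by blast
qed

text \<open>A run that stays among the time-stamp configurations forces each \<open>V t\<close> to
  be the block \<open>W (l + t)\<close>. Without a shift every run therefore reaches
  \<open>err\<close>, and the limit set is contained in \<open>{err}\<close>.\<close>

lemma shift_if_limit_set_nontrivial:
  assumes V: "periodic_blocks n q V"
    and y: "y \<in> limit_set (configs n alphabet) (run net V q)" "y \<noteq> err"
  shows "\<exists>l. \<forall>t. V t = W (l + t)"
proof (rule ccontr)
  interpret V: periodic_blocks n q V by fact
  let ?X = "configs n alphabet"
  assume no_shift: "\<nexists>l. \<forall>t. V t = W (l + t)"
  have "\<exists>t. \<forall>l\<ge>p. run net V t x \<noteq> conf l" for x
  proof (rule ccontr)
    assume "\<nexists>t. \<forall>l\<ge>p. run net V t x \<noteq> conf l"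
    then have stay: "\<exists>l\<ge>p. run net V t x = conf l" for t by blast
    obtain l where l: "p \<le> l" "x = conf l" using stay[of 0] by auto
    have step: "V t = W (l + t)" if "run net V t x = conf (l + t)" for t
    proof -
      obtain j where "p \<le> j" "run net V (Suc t) x = conf j" using stay by blast
      then show ?thesis
        using block_update_wrong_block[of "l + t" "V t" j] l that
          V.block_subset V.block_nonempty by simp
    qed
    have "run net V t x = conf (l + t)" for t
    proof (induction t)
      case (Suc t)
      then show ?case using step[OF Suc] block_update_conf[of "l + t"] l by simp
    qed (use l in simp)
    then show False using step no_shift by blast
  qed
  then have "\<exists>t. \<forall>s\<ge>t. run net V s x = err" if "x \<in> ?X" for x
    using run_reaches_err[OF V that] by meson
  then obtain T where T: "\<And>x s. x \<in> ?X \<Longrightarrow> T x \<le> s \<Longrightarrow> run net V s x = err" by metis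
  \<comment> \<open>Finiteness gives one bound for all starting configurations. It serves as a
    number of periods, since \<open>K \<le> K * q\<close>.\<close>
  define K where "K = Max (T ` ?X)"
  have "T x \<le> K * q" if "x \<in> ?X" for x
  proof -
    have "T x \<le> K"
      unfolding K_def using that finite_configs[OF automata_network_net] by simp
    also have "\<dots> \<le> K * q" using V.period_pos by simp
    finally show ?thesis .
  qed
  then have "(run net V q ^^ K) x = err" if "x \<in> ?X" for x
    using T that by (simp add: V.run_funpow)
  moreover have "y \<in> (run net V q ^^ K) ` ?X" using y(1) by (simp add: limit_set_def)
  ultimately show False using y(2) by auto
qed

lemma shift_if_dyn_iso:
  assumes V: "periodic_blocks n q V"
    and iso: "dyn_iso (limit_set (configs n alphabet) (run net W p)) g
                      (limit_set (configs n alphabet) (run net V q)) h"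
  shows "\<exists>l. \<forall>t. V t = W (l + t)"
proof -
  obtain \<pi> where \<pi>: "bij_betw \<pi> (limit_set (configs n alphabet) (run net W p))
      (limit_set (configs n alphabet) (run net V q))"
    using iso unfolding dyn_iso_def by blast
  \<comment> \<open>Only the bijection matters: two distinct limit configurations along
    \<open>W\<close> force one other than \<open>err\<close> along \<open>V\<close>.\<close>
  have "\<pi> (conf p) \<noteq> \<pi> err"
    using \<pi> conf_in_limit_set err_in_limit_set conf_neq_err
    unfolding bij_betw_def by (metis inj_on_eq_iff)
  then obtain y where "y \<in> {\<pi> (conf p), \<pi> err}" "y \<noteq> err" by (metis insertCI)
  moreover have "{\<pi> (conf p), \<pi> err} \<subseteq> limit_set (configs n alphabet) (run net V q)"
    using \<pi> conf_in_limit_set err_in_limit_set by (auto dest: bij_betwE)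
  ultimately show ?thesis using shift_if_limit_set_nontrivial[OF V] by blast
qed

end

section \<open>Blocks of a partitioned order\<close>

lemma BP_eq_if_common_element:
  assumes "\<mu> \<in> BP n" "S \<in> \<mu>" "T \<in> \<mu>" "i \<in> set S" "i \<in> set T"
  shows "S = T"
proof (rule ccontr)
  assume "S \<noteq> T"
  then have "set S \<inter> set T = {}"
    using assms(1-3) by (simp add: BP_def pairwise_def)
  then show False using assms(4,5) by blast
qed

lemma finite_BP:
  assumes "\<mu> \<in> BP n" shows "finite \<mu>"
proof (rule finite_imageD)
  have "set ` \<mu> \<subseteq> Pow {..<n}" using assms by (auto simp: BP_def)
  then show "finite (set ` \<mu>)" by (rule finite_subset) simp
  show "inj_on set \<mu>"
  proof (rule inj_onI)
    fix S T assume ST: "S \<in> \<mu>" "T \<in> \<mu>" "set S = set T"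
    then have "S \<noteq> []" using assms by (simp add: BP_def)
    then have "hd S \<in> set S" by simp
    then show "S = T" using BP_eq_if_common_element[OF assms ST(1,2)] ST(3) by simp
  qed
qed

lemma BP_length_pos: "\<mu> \<in> BP n \<Longrightarrow> S \<in> \<mu> \<Longrightarrow> 0 < length S"
  by (auto simp: BP_def)

lemma LCM_length_pos:
  assumes "\<mu> \<in> BP n" shows "0 < (LCM S\<in>\<mu>. length S)"
proof -
  have "0 \<notin> length ` \<mu>" using BP_length_pos[OF assms] by fastforce
  then have "(LCM S\<in>\<mu>. length S) \<noteq> 0" using finite_BP[OF assms] by (simp add: Lcm_0_iff)
  then show ?thesis by simp
qed

text \<open>By disjointness only \<open>S\<close> itself contributes an element of
  \<open>set S\<close>, so a block can be read off sequence by sequence.\<close>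

lemma block_Int:
  assumes "\<mu> \<in> BP n" "S \<in> \<mu>"
  shows "block \<mu> l \<inter> set S = {S ! (l mod length S)}"
proof -
  have "T = S" if "T \<in> \<mu>" "T ! (l mod length T) \<in> set S" for T
  proof -
    have "T ! (l mod length T) \<in> set T" using BP_length_pos[OF assms(1) that(1)] by simp
    then show ?thesis using BP_eq_if_common_element assms that by blast
  qed
  then show ?thesis
    using assms(2) BP_length_pos[OF assms] by (auto simp: block_def)
qed

text \<open>Each sequence has distinct entries, so a block determines the residue of its index
  modulo every length, and hence modulo their \<open>LCM\<close>.\<close>

lemma block_eq_iff:
  assumes "\<mu> \<in> BP n"
  shows "block \<mu> a = block \<mu> b \<longleftrightarrow> a mod (LCM S\<in>\<mu>. length S) = b mod (LCM S\<in>\<mu>. length S)"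
proof -
  have "block \<mu> a = block \<mu> b \<longleftrightarrow> (\<forall>S\<in>\<mu>. a mod length S = b mod length S)"
  proof
    assume eq: "block \<mu> a = block \<mu> b"
    show "\<forall>S\<in>\<mu>. a mod length S = b mod length S"
    proof
      fix S assume S: "S \<in> \<mu>"
      then have "S ! (a mod length S) = S ! (b mod length S)"
        using eq block_Int[OF assms S] by (metis singleton_inject)
      moreover have "distinct S" using S assms by (simp add: BP_def)
      ultimately show "a mod length S = b mod length S"
        using BP_length_pos[OF assms S] by (simp add: nth_eq_iff_index_eq)
    qed
  next
    assume "\<forall>S\<in>\<mu>. a mod length S = b mod length S"
    then show "block \<mu> a = block \<mu> b"
      unfolding block_def by (intro Collect_cong) metis
  qed
  also have "\<dots> \<longleftrightarrow> (LCM S\<in>\<mu>. length S) dvd nat \<bar>int a - int b\<bar>"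
    by (simp add: nat_mod_eq_iff_dvd_diff Lcm_dvd_iff del: dvd_nat_abs_iff)
  also have "\<dots> \<longleftrightarrow> a mod (LCM S\<in>\<mu>. length S) = b mod (LCM S\<in>\<mu>. length S)"
    by (rule nat_mod_eq_iff_dvd_diff[symmetric])
  finally show ?thesis .
qed

lemma periodic_blocks_BP:
  assumes "1 \<le> n" "\<mu> \<in> BP n"
  shows "periodic_blocks n (LCM S\<in>\<mu>. length S) (block \<mu>)"
proof
  show "block \<mu> t \<noteq> {}" for t
  proof -
    have "0 \<in> (\<Union>S\<in>\<mu>. set S)" using assms by (simp add: BP_def)
    then have "\<mu> \<noteq> {}" by auto
    then show ?thesis by (auto simp: block_def)
  qed
  show "block \<mu> t \<subseteq> {..<n}" for t
  proof
    fix i assume "i \<in> block \<mu> t"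
    then obtain S where S: "S \<in> \<mu>" "i = S ! (t mod length S)" by (auto simp: block_def)
    then have "i \<in> set S" using BP_length_pos[OF assms(2)] by simp
    moreover have "(\<Union>S\<in>\<mu>. set S) = {..<n}" using assms(2) by (simp add: BP_def)
    ultimately show "i \<in> {..<n}" using S(1) by blast
  qed
  show "\<exists>t<LCM S\<in>\<mu>. length S. i \<in> block \<mu> t" if "i < n" for i
  proof -
    have "i \<in> (\<Union>S\<in>\<mu>. set S)" using assms(2) that by (simp add: BP_def)
    then obtain S where S: "S \<in> \<mu>" "i \<in> set S" by (rule UN_E)
    then obtain t where t: "t < length S" "S ! t = i" by (meson in_set_conv_nth)
    have "length S dvd (LCM S\<in>\<mu>. length S)" using S(1) by (intro dvd_Lcm imageI)
    then have "length S \<le> (LCM S\<in>\<mu>. length S)"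
      using LCM_length_pos[OF assms(2)] by (rule dvd_imp_le)
    then have "t < (LCM S\<in>\<mu>. length S)" using t(1) by simp
    moreover have "i \<in> block \<mu> t"
      unfolding block_def by (intro CollectI exI[of _ S] conjI S(1)) (simp add: t)
    ultimately show ?thesis by blast
  qed
  show "0 < (LCM S\<in>\<mu>. length S)" by (rule LCM_length_pos[OF assms(2)])
  show "block \<mu> (t + (LCM S\<in>\<mu>. length S)) = block \<mu> t" for t
    unfolding block_eq_iff[OF assms(2)] by (rule mod_add_self2)
qed

lemma equiv_star_if_shift:
  assumes \<mu>: "\<mu> \<in> BP n" and \<mu>': "\<mu>' \<in> BP n"
    and shift: "\<And>t. block \<mu>' t = block \<mu> (l + t)"
  shows "\<mu> \<equiv>\<^sub>\<star> \<mu>'"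
proof -
  define p where "p = (LCM S\<in>\<mu>. length S)"
  define q where "q = (LCM S\<in>\<mu>'. length S)"
  note eq = block_eq_iff[OF \<mu>, folded p_def] and eq' = block_eq_iff[OF \<mu>', folded q_def]
  \<comment> \<open>The blocks of \<open>\<mu>'\<close> at \<open>q\<close> and \<open>0\<close>
    agree, so the shift makes those of \<open>\<mu>\<close> at \<open>l + q\<close> and
    \<open>l\<close> agree.\<close>
  have "p dvd q"
    using eq[of "l + q" l] eq'[of q 0] shift[of q] shift[of 0]
    by (simp add: mod_eq_dvd_iff_nat)
  moreover have "q dvd p"
    using eq[of "l + p" l] eq'[of p 0] shift[of p] shift[of 0]
    by (simp add: mod_eq_0_iff_dvd)
  ultimately have pq: "q = p" by (simp add: dvd_antisym)
  have p: "0 < p" using LCM_length_pos[OF \<mu>] by (simp add: p_def)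
  have len: "length (phi \<mu>) = p" "length (phi \<mu>') = p"
    using pq by (simp_all add: phi_def p_def q_def)
  have "phi \<mu> = circ_shift (int (l mod p)) (phi \<mu>')"
  proof (rule nth_equalityI)
    fix j assume "j < length (phi \<mu>)"
    then have j: "j < p" using len by simp
    \<comment> \<open>The position of \<open>phi \<mu>'\<close> from which the shifted list takes
      its entry \<open>j\<close>.\<close>
    define r where "r = nat ((int j - int (l mod p)) mod int p)"
    have r: "int r = (int j - int (l mod p)) mod int p" using p by (simp add: r_def)
    then have "r < p" using p by (metis of_nat_0_less_iff of_nat_less_iff pos_mod_bound)
    have "int ((l + r) mod p) = int (j mod p)"
      by (simp add: of_nat_mod r mod_simps)
    then have "block \<mu> (l + r) = block \<mu> j" using eq by simp
    then show "phi \<mu> ! j = circ_shift (int (l mod p)) (phi \<mu>') ! j"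
      using j \<open>r < p\<close> len shift pq
      by (simp add: circ_shift_def r_def[symmetric]) (simp add: phi_def p_def q_def)
  qed (simp add: circ_shift_def len)
  moreover have "l mod p < length (phi \<mu>')" using p len by simp
  ultimately show ?thesis unfolding equiv_star_def by blast
qed

theorem lemma4:
  fixes n :: nat and \<mu> \<mu>' :: "nat list set"
  assumes "n \<ge> 1" and "\<mu> \<in> BP n" and "\<mu>' \<in> BP n"
  shows "\<mu> \<equiv>\<^sub>\<star> \<mu>' \<longleftrightarrow>
    (\<forall>(A :: nat \<Rightarrow> 'a::infinite set) (f :: (nat \<Rightarrow> 'a) \<Rightarrow> (nat \<Rightarrow> 'a)).
       automata_network n A f \<longrightarrow> same_limit_dynamics (configs n A) f \<mu> \<mu>')"
proof
  assume "\<mu> \<equiv>\<^sub>\<star> \<mu>'"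
  then show "\<forall>(A :: nat \<Rightarrow> 'a set) f.
      automata_network n A f \<longrightarrow> same_limit_dynamics (configs n A) f \<mu> \<mu>'"
    by (blast intro: equiv_star_imp_same_limit_dynamics)
next
  assume same: "\<forall>(A :: nat \<Rightarrow> 'a set) f.
      automata_network n A f \<longrightarrow> same_limit_dynamics (configs n A) f \<mu> \<mu>'"
  \<comment> \<open>The alphabet of the network has \<open>2p + 1\<close> symbols, with
    \<open>p\<close> depending on \<open>\<mu>\<close>; an infinite type holds them for every
    \<open>p\<close>.\<close>
  obtain e :: "nat \<Rightarrow> 'a" where e: "inj e"
    using infinite_countable_subset[OF infinite_UNIV] by blast
  interpret W: periodic_blocks n "LCM S\<in>\<mu>. length S" "block \<mu>"
    by (rule periodic_blocks_BP[OF assms(1,2)])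
  interpret stamp_network n "LCM S\<in>\<mu>. length S" "block \<mu>" e
    by unfold_locales (rule e)
  have "same_limit_dynamics (configs n alphabet) net \<mu> \<mu>'"
    using same automata_network_net by blast
  then obtain l where "\<forall>t. block \<mu>' t = block \<mu> (l + t)"
    using shift_if_dyn_iso[OF periodic_blocks_BP[OF assms(1,3)]]
    unfolding same_limit_dynamics_def update_eq_run by blast
  then show "\<mu> \<equiv>\<^sub>\<star> \<mu>'" using equiv_star_if_shift[OF assms(2,3)] by blast
qed

end
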